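(* If $\nu>-1$ and $z\in\mathbb{C}$, then $$J_{\nu+1}(z) I_{\nu}(z) + J_{\nu}(z)I_{\nu+1}(z)=2\sum_{n \geq 0}\frac{(-1)^n\left( \frac{z}{2}\right)^{2\nu+4n+1}}{n!\,\Gamma(\nu+n+1)\,\Gamma(\nu+2n+2)}.$$
   Context: $J_\nu$ and $I_\nu$ are the Bessel and modified Bessel functions of the first kind of order $\nu$, and $\Gamma$ is the Euler gamma function. When $\nu$ is not an integer, the powers of $z/2$ in the Bessel functions and on the right-hand side are taken with the same branch, so that $(z/2)^{2\nu+4n+1}=(z/2)^{\nu}(z/2)^{\nu+1}(z/2)^{4n}$; equivalently, the identity holds between the entire functions obtained after dividing both sides by $(z/2)^{2\nu+1}$. *)

theory Defs
  imports "HOL-Analysis.Analysis"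
begin

text \<open>
  The power \<open>w\<^sup>a\<close> formed with the branch \<open>Ln w + 2 \<pi> \<i> k\<close> of the logarithm. For \<open>w \<noteq> 0\<close>
  every value of the logarithm of \<open>w\<close> arises for exactly one \<open>k\<close>, and for integer \<open>a\<close> the result
  does not depend on \<open>k\<close>. Unlike \<open>powr\<close>, this satisfies \<open>0\<^sup>0 = 1\<close>, which is needed for
  \<open>J\<^sub>0(0) = I\<^sub>0(0) = 1\<close>. The value at \<open>w = 0\<close> is meaningful only for \<open>a \<ge> 0\<close>.
\<close>

definition branch_pow :: "int \<Rightarrow> complex \<Rightarrow> real \<Rightarrow> complex" where
  "branch_pow k w a =
     (if w = 0 then (if a = 0 then 1 else 0)
      else exp (of_real a * (Ln w + 2 * of_real pi * \<i> * of_int k)))"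

text \<open>The entire functions \<open>(z/2)\<^sup>-\<^sup>\<nu> J\<^sub>\<nu>(z)\<close> and \<open>(z/2)\<^sup>-\<^sup>\<nu> I\<^sub>\<nu>(z)\<close>.\<close>

definition bessel_J_entire :: "real \<Rightarrow> complex \<Rightarrow> complex" where
  "bessel_J_entire \<nu> z =
     (\<Sum>n. (-1) ^ n * (z / 2) ^ (2 * n) / (fact n * of_real (Gamma (\<nu> + real n + 1))))"

definition bessel_I_entire :: "real \<Rightarrow> complex \<Rightarrow> complex" where
  "bessel_I_entire \<nu> z =
     (\<Sum>n. (z / 2) ^ (2 * n) / (fact n * of_real (Gamma (\<nu> + real n + 1))))"

text \<open>
  Bessel and modified Bessel functions of the first kind, on the branch \<open>k\<close>. At \<open>z = 0\<close> these are
  the classical values only for \<open>\<nu> \<ge> 0\<close>.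
\<close>

definition bessel_J :: "int \<Rightarrow> real \<Rightarrow> complex \<Rightarrow> complex" where
  "bessel_J k \<nu> z = branch_pow k (z / 2) \<nu> * bessel_J_entire \<nu> z"

definition bessel_I :: "int \<Rightarrow> real \<Rightarrow> complex \<Rightarrow> complex" where
  "bessel_I k \<nu> z = branch_pow k (z / 2) \<nu> * bessel_I_entire \<nu> z"

end

theory Submission
  imports Defs
begin

text \<open>
  Divided by the common power of \<open>z / 2\<close>, all four functions are everywhere absolutely convergent
  power series in \<open>w = (z / 2)\<^sup>2\<close>, with coefficients \<open>c\<^sub>\<nu> n = 1 / (n! \<Gamma>(\<nu> + n + 1))\<close>, the ones
  of \<open>J\<close> carrying an additional sign \<open>(-1)\<^sup>n\<close>. So both products may be expanded by Cauchy's rule.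
  The coefficient of \<open>w\<^sup>k\<close> in the sum of the products is
  \<open>\<Sum>i\<le>k. ((-1)\<^sup>i + (-1)\<^bsup>k-i\<^esup>) c\<^bsub>\<nu>+1\<^esub> i c\<^sub>\<nu> (k - i)\<close>: it vanishes for odd \<open>k\<close>, and for even
  \<open>k\<close> it is twice an alternating sum.

  With \<open>s = \<nu> + k\<close>, the Gamma factors turn into generalised binomial coefficients,
  \<open>c\<^bsub>\<nu>+1\<^esub> i c\<^sub>\<nu> (k - i) = (s gchoose i) (s + 1 gchoose (k - i)) / (\<Gamma>(s + 1) \<Gamma>(s + 2))\<close>, so the
  alternating sum is, up to this denominator, the coefficient of \<open>X\<^sup>k\<close> in the formal power series
  \<open>(1 - X)\<^sup>s (1 + X)\<^bsup>s+1\<^esup> = (1 - X\<^sup>2)\<^sup>s (1 + X)\<close>, which for \<open>k = 2 n\<close> is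
  \<open>(-1)\<^sup>n (s gchoose n)\<close>. Turning the binomial coefficient back into Gamma values gives the stated
  coefficient (\<open>alternating_sum_bessel_coeff\<close>). The version with branches follows because a power
  on a fixed branch is multiplicative in its exponent.
\<close>

section \<open>The alternating Vandermonde sum\<close>

unbundle no vec_syntax and fps_syntax

text \<open>The formal power series \<open>(1 - X)\<^sup>s\<close>.\<close>

definition fps_binomial_neg :: "'a :: field_char_0 \<Rightarrow> 'a fps" where
  "fps_binomial_neg s = Abs_fps (\<lambda>n. (-1) ^ n * (s gchoose n))"

lemma gbinomial_Suc_recurrence:
  fixes s :: "'a :: field_char_0"
  shows "of_nat (Suc n) * (s gchoose Suc n) = s * (s gchoose n) - of_nat n * (s gchoose n)"
  using gbinomial_mult_1[of s n] by (simp add: algebra_simps)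

lemma fps_binomial_ODE:
  fixes s :: "'a :: field_char_0"
  shows "(1 + fps_X) * fps_deriv (fps_binomial s) = fps_const s * fps_binomial s"
proof (rule fps_ext)
  fix n
  show "((1 + fps_X) * fps_deriv (fps_binomial s)) $ n = (fps_const s * fps_binomial s) $ n"
    using gbinomial_Suc_recurrence[of n s]
    by (cases n) (simp_all add: distrib_right del: of_nat_Suc)
qed

lemma fps_binomial_neg_ODE:
  fixes s :: "'a :: field_char_0"
  shows "(1 - fps_X) * fps_deriv (fps_binomial_neg s) = - (fps_const s * fps_binomial_neg s)"
proof (rule fps_ext)
  fix n
  have "of_nat (Suc n) * ((-1) ^ Suc n * (s gchoose Suc n)) =
        (-1) ^ Suc n * (s * (s gchoose n) - of_nat n * (s gchoose n))"
    by (subst gbinomial_Suc_recurrence[symmetric]) (simp add: algebra_simps)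
  then show "((1 - fps_X) * fps_deriv (fps_binomial_neg s)) $ n = (- (fps_const s * fps_binomial_neg s)) $ n"
    by (cases n) (simp_all add: fps_binomial_neg_def left_diff_distrib algebra_simps)
qed

text \<open>
  The product is \<open>(1 - X\<^sup>2)\<^sup>s\<close>. Its coefficients are read off from the differential equation
  \<open>(1 - X\<^sup>2) F' = - 2 s X F\<close>, which makes the one at \<open>1\<close> vanish and then determines
  them all, two steps at a time, from those at \<open>0\<close> and \<open>1\<close>.
\<close>

lemma fps_binomial_neg_mult_binomial_nth:
  fixes s :: "'a :: field_char_0"
  shows "(fps_binomial_neg s * fps_binomial s) $ (2 * n) = (-1) ^ n * (s gchoose n)"
    and "(fps_binomial_neg s * fps_binomial s) $ (2 * n + 1) = 0"
proof -
  define F where "F = fps_binomial_neg s * fps_binomial s"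
  let ?P = "fps_binomial s" and ?M = "fps_binomial_neg s"
  have "(1 - fps_X) * (1 + fps_X) * fps_deriv F =
          (1 - fps_X) * ?M * ((1 + fps_X) * fps_deriv ?P) +
          (1 + fps_X) * ?P * ((1 - fps_X) * fps_deriv ?M)"
    by (simp add: F_def algebra_simps)
  also have "\<dots> = fps_X * (fps_const (-2 * s) * F)"
    unfolding fps_binomial_ODE fps_binomial_neg_ODE
    by (simp add: F_def algebra_simps flip: fps_const_mult fps_const_neg numeral_fps_const)
  finally have ODE: "fps_deriv F - fps_X * (fps_X * fps_deriv F) = fps_X * (fps_const (-2 * s) * F)"
    by (simp add: algebra_simps)
  have rec: "of_nat (m + 2) * F $ (m + 2) = (of_nat m - 2 * s) * F $ m" for m
  proof -
    have "of_nat (m + 2) * F $ (m + 2) - of_nat m * F $ m = - (2 * s * F $ m)"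
      using arg_cong[OF ODE, of "\<lambda>f. f $ Suc m"] by (cases m) simp_all
    then show ?thesis by (simp add: algebra_simps)
  qed
  have F1: "F $ 1 = 0"
    using arg_cong[OF ODE, of "\<lambda>f. f $ 0"] by simp
  have F0: "F $ 0 = 1"
    by (simp add: F_def fps_binomial_neg_def fps_mult_nth)
  have "F $ (2 * n) = (-1) ^ n * (s gchoose n)"
  proof (induction n)
    case (Suc n)
    have "2 * of_nat (Suc n) * F $ (2 * Suc n) = 2 * (of_nat n - s) * F $ (2 * n)"
      using rec[of "2 * n"] by (simp add: algebra_simps)
    also have "\<dots> = 2 * ((-1) ^ Suc n * (s * (s gchoose n) - of_nat n * (s gchoose n)))"
      unfolding Suc.IH by (simp add: algebra_simps)
    also have "\<dots> = 2 * of_nat (Suc n) * ((-1) ^ Suc n * (s gchoose Suc n))"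
      by (subst gbinomial_Suc_recurrence[symmetric]) (simp only: mult_ac)
    finally show ?case
      by (subst (asm) mult_cancel_left) (simp del: of_nat_Suc)
  qed (simp add: F0)
  moreover have "F $ (2 * n + 1) = 0"
  proof (induction n)
    case (Suc n)
    have "of_nat (2 * n + 3) * F $ (2 * n + 3) = 0"
      using rec[of "2 * n + 1"] Suc.IH by (simp add: numeral_3_eq_3)
    then have "F $ (2 * n + 3) = 0"
      by (metis mult_eq_0_iff of_nat_eq_0_iff add_eq_0_iff_both_eq_0 zero_neq_numeral)
    then show ?case by (simp add: numeral_3_eq_3)
  qed (simp add: F1[simplified])
  ultimately show "(?M * ?P) $ (2 * n) = (-1) ^ n * (s gchoose n)" "(?M * ?P) $ (2 * n + 1) = 0"
    by (simp_all add: F_def)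
qed

text \<open>
  The left-hand side is a coefficient of \<open>(1 - X)\<^sup>s (1 + X)\<^bsup>s+1\<^esup> = (1 - X\<^sup>2)\<^sup>s (1 + X)\<close>; at an even
  exponent, the factor \<open>1 + X\<close> has no effect because \<open>(1 - X\<^sup>2)\<^sup>s\<close> contains only even powers.
\<close>

lemma alternating_gbinomial_convolution:
  fixes s :: "'a :: field_char_0"
  shows "(\<Sum>i\<le>2*n. (-1) ^ i * (s gchoose i) * (s + 1 gchoose (2 * n - i))) = (-1) ^ n * (s gchoose n)"
proof -
  let ?F = "fps_binomial_neg s * fps_binomial s"
  have "(\<Sum>i\<le>2*n. (-1) ^ i * (s gchoose i) * (s + 1 gchoose (2 * n - i))) =
          (fps_binomial_neg s * fps_binomial (s + 1)) $ (2 * n)"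
    by (simp add: fps_mult_nth fps_binomial_neg_def atLeast0AtMost)
  also have "fps_binomial_neg s * fps_binomial (s + 1) = ?F + fps_X * ?F"
    by (simp add: fps_binomial_add_mult fps_binomial_1 algebra_simps)
  also have "(?F + fps_X * ?F) $ (2 * n) = ?F $ (2 * n)"
    using fps_binomial_neg_mult_binomial_nth(2)[of s "n - 1"] by (cases n) simp_all
  finally show ?thesis
    by (simp add: fps_binomial_neg_mult_binomial_nth(1))
qed

section \<open>The coefficients of the Bessel series\<close>

definition bessel_coeff :: "real \<Rightarrow> nat \<Rightarrow> real" where
  "bessel_coeff \<nu> n = 1 / (fact n * Gamma (\<nu> + real n + 1))"

lemma gbinomial_Gamma_pos:
  fixes s :: real
  assumes "s + 1 > 0"
  shows "s gchoose n = Gamma (s + 1) / (fact n * Gamma (s - real n + 1))"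
  using assms by (intro gbinomial_Gamma) (auto elim: nonpos_Ints_cases)

text \<open>
  The factorials and Gamma values are paired crosswise, \<open>i!\<close> with the Gamma factor of the index
  \<open>k - i\<close> and conversely: then the upper entries of the binomial coefficients do not depend on \<open>i\<close>.
\<close>

lemma bessel_coeff_mult_eq_gbinomial:
  assumes "\<nu> > -1" and "i \<le> k"
  shows "bessel_coeff (\<nu> + 1) i * bessel_coeff \<nu> (k - i) =
         (\<nu> + real k gchoose i) * (\<nu> + real k + 1 gchoose (k - i)) /
           (Gamma (\<nu> + real k + 1) * Gamma (\<nu> + real k + 2))"
proof -
  have pos: "Gamma (\<nu> + real k + 1) > 0" "Gamma (\<nu> + real k + 2) > 0"
    using assms by (auto intro!: Gamma_real_pos)
  have "\<nu> + real k gchoose i = Gamma (\<nu> + real k + 1) / (fact i * Gamma (\<nu> + real (k - i) + 1))"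
    using assms by (subst gbinomial_Gamma_pos) (simp_all add: of_nat_diff algebra_simps)
  moreover have "\<nu> + real k + 1 gchoose (k - i) =
      Gamma (\<nu> + real k + 2) / (fact (k - i) * Gamma (\<nu> + 1 + real i + 1))"
    using assms by (subst gbinomial_Gamma_pos) (simp_all add: of_nat_diff algebra_simps)
  ultimately show ?thesis
    using pos by (simp add: bessel_coeff_def)
qed

lemma alternating_sum_bessel_coeff:
  assumes "\<nu> > -1"
  shows "(\<Sum>i\<le>2*n. (-1) ^ i * bessel_coeff (\<nu> + 1) i * bessel_coeff \<nu> (2 * n - i)) =
         (-1) ^ n / (fact n * Gamma (\<nu> + real n + 1) * Gamma (\<nu> + 2 * real n + 2))"
proof -
  define s where "s = \<nu> + real (2 * n)"
  have pos: "Gamma (s + 1) > 0"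
    using assms by (auto simp: s_def intro!: Gamma_real_pos)
  have "(\<Sum>i\<le>2*n. (-1) ^ i * bessel_coeff (\<nu> + 1) i * bessel_coeff \<nu> (2 * n - i)) =
        (\<Sum>i\<le>2*n. (-1) ^ i * (s gchoose i) * (s + 1 gchoose (2 * n - i))) / (Gamma (s + 1) * Gamma (s + 2))"
    unfolding sum_divide_distrib
  proof (rule sum.cong)
    fix i assume "i \<in> {..2 * n}"
    then show "(-1) ^ i * bessel_coeff (\<nu> + 1) i * bessel_coeff \<nu> (2 * n - i) =
        (-1) ^ i * (s gchoose i) * (s + 1 gchoose (2 * n - i)) / (Gamma (s + 1) * Gamma (s + 2))"
      using bessel_coeff_mult_eq_gbinomial[OF assms, of i "2 * n"] by (simp add: s_def mult.assoc)
  qed simp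
  also have "\<dots> = (-1) ^ n * (s gchoose n) / (Gamma (s + 1) * Gamma (s + 2))"
    by (simp only: alternating_gbinomial_convolution)
  also have "s gchoose n = Gamma (s + 1) / (fact n * Gamma (\<nu> + real n + 1))"
    using assms by (subst gbinomial_Gamma_pos) (simp_all add: s_def algebra_simps)
  finally show ?thesis
    using pos by (simp add: s_def)
qed

section \<open>The product of the series\<close>

lemma bessel_coeff_Suc:
  assumes "\<nu> > -1"
  shows "bessel_coeff \<nu> (Suc n) = bessel_coeff \<nu> n / (real (Suc n) * (\<nu> + real n + 1))"
proof -
  have "Gamma (\<nu> + real n + 1 + 1) = (\<nu> + real n + 1) * Gamma (\<nu> + real n + 1)"
    using assms by (intro Gamma_plus1) (auto elim: nonpos_Ints_cases)
  then show ?thesis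
    by (simp add: bessel_coeff_def add_ac mult_ac)
qed

text \<open>
  The ratio of successive terms is \<open>w / ((n + 1) (\<nu> + n + 1))\<close>, whose denominator is at least \<open>n\<close>
  for \<open>n \<ge> 1\<close>; so it is at most \<open>1 / 2\<close> in norm as soon as \<open>n \<ge> max 1 (2 \<bar>w\<bar>)\<close>.
\<close>

lemma summable_norm_bessel_series:
  fixes w :: complex
  assumes "\<nu> > -1"
  shows "summable (\<lambda>n. norm (of_real (bessel_coeff \<nu> n) * w ^ n))"
proof -
  define N where "N = nat \<lceil>2 * norm w\<rceil> + 1"
  show ?thesis
  proof (rule summable_ratio_test[where N = N])
    show "(1 / 2 :: real) < 1" by simp
    fix n assume "n \<ge> N"
    then have n: "real n \<ge> 2 * norm w" "real n \<ge> 1"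
      unfolding N_def by linarith+
    have "real n * 1 \<le> real (Suc n) * (\<nu> + real n + 1)"
      using n assms by (intro mult_mono) auto
    then have "2 * norm w \<le> real (Suc n) * (\<nu> + real n + 1)"
      using n by linarith
    moreover have D: "real (Suc n) * (\<nu> + real n + 1) > 0"
      using assms by (intro mult_pos_pos) auto
    ultimately have "norm w / (real (Suc n) * (\<nu> + real n + 1)) \<le> 1 / 2"
      by (simp add: pos_divide_le_eq del: of_nat_Suc)
    then have "norm w / (real (Suc n) * (\<nu> + real n + 1)) * (\<bar>bessel_coeff \<nu> n\<bar> * norm w ^ n)
                 \<le> 1 / 2 * (\<bar>bessel_coeff \<nu> n\<bar> * norm w ^ n)"
      by (intro mult_right_mono) auto
    moreover have "norm (of_real (bessel_coeff \<nu> (Suc n)) * w ^ Suc n) =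
        norm w / (real (Suc n) * (\<nu> + real n + 1)) * (\<bar>bessel_coeff \<nu> n\<bar> * norm w ^ n)"
    proof -
      have "\<bar>bessel_coeff \<nu> (Suc n)\<bar> = \<bar>bessel_coeff \<nu> n\<bar> / (real (Suc n) * (\<nu> + real n + 1))"
        unfolding bessel_coeff_Suc[OF assms] abs_divide using D by (simp only: abs_of_pos)
      then show ?thesis
        by (simp add: norm_mult norm_power del: of_nat_Suc)
    qed
    moreover have "norm (of_real (bessel_coeff \<nu> n) * w ^ n) = \<bar>bessel_coeff \<nu> n\<bar> * norm w ^ n"
      by (simp add: norm_mult norm_power)
    ultimately have "norm (of_real (bessel_coeff \<nu> (Suc n)) * w ^ Suc n) \<le>
        1 / 2 * norm (of_real (bessel_coeff \<nu> n) * w ^ n)"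
      by (simp only:)
    then show "norm (norm (of_real (bessel_coeff \<nu> (Suc n)) * w ^ Suc n)) \<le>
        1 / 2 * norm (norm (of_real (bessel_coeff \<nu> n) * w ^ n))"
      by (simp only: real_norm_def abs_norm_cancel)
  qed
qed

lemma bessel_I_entire_eq:
  "bessel_I_entire \<nu> z = (\<Sum>n. of_real (bessel_coeff \<nu> n) * ((z / 2)\<^sup>2) ^ n)"
  unfolding bessel_I_entire_def bessel_coeff_def by (simp add: power_mult)

lemma bessel_J_entire_eq:
  "bessel_J_entire \<nu> z = (\<Sum>n. (-1) ^ n * (of_real (bessel_coeff \<nu> n) * ((z / 2)\<^sup>2) ^ n))"
  unfolding bessel_J_entire_def bessel_coeff_def by (simp add: power_mult)

text \<open>
  In the second product the factor with the shifted order is taken first, so that the two Cauchy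
  products have the same terms up to sign and can be added term by term.
\<close>

lemma bessel_entire_product_sums:
  assumes "\<nu> > -1"
  shows "(\<lambda>n. 2 * ((-1) ^ n * (z / 2) ^ (4 * n) /
            (fact n * of_real (Gamma (\<nu> + real n + 1)) * of_real (Gamma (\<nu> + 2 * real n + 2)))))
         sums (bessel_J_entire (\<nu> + 1) z * bessel_I_entire \<nu> z +
               bessel_J_entire \<nu> z * bessel_I_entire (\<nu> + 1) z)"
proof -
  define w where "w = (z / 2)\<^sup>2"
  define t where "t n = complex_of_real (bessel_coeff \<nu> n) * w ^ n" for n
  define u where "u n = complex_of_real (bessel_coeff (\<nu> + 1) n) * w ^ n" for n
  define f where "f k = (\<Sum>i\<le>k. ((-1) ^ i * u i) * t (k - i)) + (\<Sum>i\<le>k. u i * ((-1) ^ (k - i) * t (k - i)))" for k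
  have t: "summable (\<lambda>n. norm (t n))" and u: "summable (\<lambda>n. norm (u n))"
    unfolding t_def u_def using assms by (auto intro!: summable_norm_bessel_series)
  then have t': "summable (\<lambda>n. norm ((-1) ^ n * t n))" and u': "summable (\<lambda>n. norm ((-1) ^ n * u n))"
    by (simp_all add: norm_mult norm_power)
  have "f sums ((\<Sum>n. (-1) ^ n * u n) * (\<Sum>n. t n) + (\<Sum>n. u n) * (\<Sum>n. (-1) ^ n * t n))"
    unfolding f_def by (intro sums_add Cauchy_product_sums t u t' u')
  then have "f sums (bessel_J_entire (\<nu> + 1) z * bessel_I_entire \<nu> z +
               bessel_J_entire \<nu> z * bessel_I_entire (\<nu> + 1) z)"
    by (simp add: bessel_J_entire_eq bessel_I_entire_eq t_def u_def w_def mult.commute)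
  moreover have "f k = 0" if "k \<notin> range (\<lambda>n. 2 * n)" for k
  proof -
    have "odd k" using that by (auto elim!: evenE)
    then have "(-1) ^ i * u i * t (k - i) + u i * ((-1) ^ (k - i) * t (k - i)) = 0" if "i \<le> k" for i
      using that by (cases "even i") simp_all
    then show ?thesis
      by (simp add: f_def flip: sum.distrib)
  qed
  moreover have "strict_mono (\<lambda>n :: nat. 2 * n)"
    by (auto simp: strict_mono_def)
  ultimately have "(\<lambda>n. f (2 * n)) sums (bessel_J_entire (\<nu> + 1) z * bessel_I_entire \<nu> z +
               bessel_J_entire \<nu> z * bessel_I_entire (\<nu> + 1) z)"
    by (subst sums_mono_reindex)
  moreover have "f (2 * n) = 2 * ((-1) ^ n * (z / 2) ^ (4 * n) /
            (fact n * of_real (Gamma (\<nu> + real n + 1)) * of_real (Gamma (\<nu> + 2 * real n + 2))))" for n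
  proof -
    have "f (2 * n) = (\<Sum>i\<le>2*n. 2 * w ^ (2 * n) *
        of_real ((-1) ^ i * bessel_coeff (\<nu> + 1) i * bessel_coeff \<nu> (2 * n - i)))"
      unfolding f_def sum.distrib[symmetric]
    proof (rule sum.cong)
      fix i assume "i \<in> {..2 * n}"
      then have i: "i \<le> 2 * n" by simp
      have sgn: "(-1 :: complex) ^ (2 * n - i) = (-1) ^ i"
        using i by (cases "even i") simp_all
      have pw: "w ^ (2 * n) = w ^ i * w ^ (2 * n - i)"
        using i by (simp flip: power_add)
      show "(-1) ^ i * u i * t (2 * n - i) + u i * ((-1) ^ (2 * n - i) * t (2 * n - i)) =
          2 * w ^ (2 * n) * of_real ((-1) ^ i * bessel_coeff (\<nu> + 1) i * bessel_coeff \<nu> (2 * n - i))"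
        unfolding sgn pw by (simp add: t_def u_def)
    qed simp
    also have "\<dots> = 2 * w ^ (2 * n) *
        of_real (\<Sum>i\<le>2*n. (-1) ^ i * bessel_coeff (\<nu> + 1) i * bessel_coeff \<nu> (2 * n - i))"
      by (simp add: sum_distrib_left)
    also have "w ^ (2 * n) = (z / 2) ^ (4 * n)"
      unfolding w_def by (simp flip: power_mult)
    finally show ?thesis
      by (simp add: alternating_sum_bessel_coeff[OF assms])
  qed
  ultimately show ?thesis by simp
qed

section \<open>Powers on a branch\<close>

text \<open>
  The hypothesis guards against \<open>0\<^sup>0 = 1\<close> at \<open>w = 0\<close>: there the right-hand side vanishes when
  \<open>\<nu> = - 1 / 2\<close> and \<open>n = 0\<close>, but the left-hand side is \<open>1\<close>.
\<close>

lemma branch_pow_split: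
  assumes "w \<noteq> 0 \<or> \<nu> \<ge> 0"
  shows "branch_pow k w (2 * \<nu> + 4 * real n + 1) =
         branch_pow k w (\<nu> + 1) * branch_pow k w \<nu> * w ^ (4 * n)"
proof (cases "w = 0")
  case True
  then show ?thesis using assms by (simp add: branch_pow_def)
next
  case False
  define L where "L = Ln w + 2 * of_real pi * \<i> * of_int k"
  have "exp L = w"
    using False by (simp add: L_def exp_add exp_integer_2pi mult_ac)
  then have w: "w ^ (4 * n) = exp (of_nat (4 * n) * L)"
    by (simp only: exp_of_nat_mult)
  have "of_real (2 * \<nu> + 4 * real n + 1) * L =
          of_real (\<nu> + 1) * L + of_real \<nu> * L + of_nat (4 * n) * L"
    by (simp add: algebra_simps)
  then show ?thesis
    using False unfolding w by (simp add: branch_pow_def exp_add flip: L_def)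
qed

theorem lemma2:
  fixes \<nu> :: real and z :: complex
  assumes "\<nu> > -1"
  shows "(z \<noteq> 0 \<or> \<nu> \<ge> 0 \<longrightarrow>
           (\<forall>k. summable (\<lambda>n. (-1) ^ n * branch_pow k (z / 2) (2 * \<nu> + 4 * real n + 1) /
                  (fact n * of_real (Gamma (\<nu> + real n + 1)) * of_real (Gamma (\<nu> + 2 * real n + 2)))) \<and>
                bessel_J k (\<nu> + 1) z * bessel_I k \<nu> z + bessel_J k \<nu> z * bessel_I k (\<nu> + 1) z =
                2 * (\<Sum>n. (-1) ^ n * branch_pow k (z / 2) (2 * \<nu> + 4 * real n + 1) /
                  (fact n * of_real (Gamma (\<nu> + real n + 1)) * of_real (Gamma (\<nu> + 2 * real n + 2)))))) \<and>
         summable (\<lambda>n. (-1) ^ n * (z / 2) ^ (4 * n) /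
                  (fact n * of_real (Gamma (\<nu> + real n + 1)) * of_real (Gamma (\<nu> + 2 * real n + 2)))) \<and>
         bessel_J_entire (\<nu> + 1) z * bessel_I_entire \<nu> z +
           bessel_J_entire \<nu> z * bessel_I_entire (\<nu> + 1) z =
         2 * (\<Sum>n. (-1) ^ n * (z / 2) ^ (4 * n) /
                  (fact n * of_real (Gamma (\<nu> + real n + 1)) * of_real (Gamma (\<nu> + 2 * real n + 2))))"
proof -
  define g where "g n = (-1) ^ n * (z / 2) ^ (4 * n) /
      (fact n * complex_of_real (Gamma (\<nu> + real n + 1)) * of_real (Gamma (\<nu> + 2 * real n + 2)))" for n
  define S where "S = bessel_J_entire (\<nu> + 1) z * bessel_I_entire \<nu> z +
      bessel_J_entire \<nu> z * bessel_I_entire (\<nu> + 1) z"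
  have "(\<lambda>n. 2 * g n) sums S"
    unfolding g_def S_def by (rule bessel_entire_product_sums[OF assms])
  from sums_mult[OF this, of "1 / 2"] have g: "g sums (S / 2)"
    by simp
  then have g_suminf: "S = 2 * suminf g"
    by (auto simp: sums_iff mult.commute[of 2])
  have "summable h \<and> bessel_J k (\<nu> + 1) z * bessel_I k \<nu> z + bessel_J k \<nu> z * bessel_I k (\<nu> + 1) z =
          2 * suminf h"
    if z: "z \<noteq> 0 \<or> \<nu> \<ge> 0" and h: "h = (\<lambda>n. (-1) ^ n * branch_pow k (z / 2) (2 * \<nu> + 4 * real n + 1) /
      (fact n * of_real (Gamma (\<nu> + real n + 1)) * of_real (Gamma (\<nu> + 2 * real n + 2))))" for k h
  proof -
    define c where "c = branch_pow k (z / 2) (\<nu> + 1) * branch_pow k (z / 2) \<nu>"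
    have "h = (\<lambda>n. c * g n)"
      using z by (simp add: h g_def c_def branch_pow_split fun_eq_iff)
    then have "h sums (c * (S / 2))"
      using sums_mult[OF g] by simp
    moreover have "bessel_J k (\<nu> + 1) z * bessel_I k \<nu> z + bessel_J k \<nu> z * bessel_I k (\<nu> + 1) z = c * S"
      by (simp add: bessel_J_def bessel_I_def c_def S_def algebra_simps)
    ultimately show ?thesis
      by (auto simp: sums_iff mult.commute[of 2])
  qed
  then show ?thesis
    using sums_summable[OF g] g_suminf unfolding g_def S_def by auto
qed

end
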